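(* For a fixed inner function $x_3$ on $\mathbb{D}$, the set of $\overline{\mathbb{E}}$-inner functions $(x_1,x_2,x_3)$ with third component $x_3$ is convex.
   Context: $\mathbb{D}$ is the open unit disc and $\mathbb{T}$ the unit circle in $\mathbb{C}$. The open tetrablock is $\mathbb{E}=\{(x_1,x_2,x_3)\in\mathbb{C}^3: 1-x_1z-x_2w+x_3zw\neq 0 \text{ whenever } |z|\le 1,|w|\le 1\}$, with closure $\overline{\mathbb{E}}$. Its distinguished boundary is $b\overline{\mathbb{E}}=\{x\in\mathbb{C}^3: x_1=\overline{x_2}x_3,\ |x_3|=1,\ |x_2|\le 1\}$. An $\overline{\mathbb{E}}$-inner function is an analytic map $f:\mathbb{D}\to\overline{\mathbb{E}}$ such that the radial limit $\lim_{r\to1^-}f(r\lambda)$ exists and belongs to $b\overline{\mathbb{E}}$ for almost all $\lambda\in\mathbb{T}$ with respect to Lebesgue measure. Convexity is with respect to pointwise operations on $\mathbb{C}^3$-valued functions. *)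

theory Defs
  imports "HOL-Analysis.Analysis"
begin

abbreviation unit_disc :: "complex set" where
  "unit_disc \<equiv> ball 0 1"

abbreviation unit_circle :: "complex set" where
  "unit_circle \<equiv> sphere 0 1"

definition tetrablock :: "(complex \<times> complex \<times> complex) set" where
  "tetrablock = {(x1, x2, x3).
     \<forall>z w. cmod z \<le> 1 \<longrightarrow> cmod w \<le> 1 \<longrightarrow> 1 - x1 * z - x2 * w + x3 * z * w \<noteq> 0}"

definition tetrablock_boundary :: "(complex \<times> complex \<times> complex) set" where
  "tetrablock_boundary = {(x1, x2, x3). x1 = cnj x2 * x3 \<and> cmod x3 = 1 \<and> cmod x2 \<le> 1}"

text \<open>Arc length on the unit circle, with total mass \<open>2 * pi\<close>.\<close>

definition circle_measure :: "complex measure" where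
  "circle_measure =
     distr (restrict_space lborel {0..<2 * pi}) (restrict_space borel unit_circle) cis"

definition radial_limit ::
    "(complex \<Rightarrow> 'b::topological_space) \<Rightarrow> complex \<Rightarrow> 'b \<Rightarrow> bool" where
  "radial_limit f \<zeta> L \<longleftrightarrow> ((\<lambda>r. f (complex_of_real r * \<zeta>)) \<longlongrightarrow> L) (at_left 1)"

definition inner_function :: "(complex \<Rightarrow> complex) \<Rightarrow> bool" where
  "inner_function \<phi> \<longleftrightarrow>
     \<phi> holomorphic_on unit_disc \<and> \<phi> ` unit_disc \<subseteq> cball 0 1 \<and>
     (AE \<zeta> in circle_measure. \<exists>L. radial_limit \<phi> \<zeta> L \<and> L \<in> unit_circle)"

text \<open>A map on the disc is represented by a total function whose values outside the disc are
  irrelevant: all conditions below only refer to values on the disc.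
  Since \<open>holomorphic_on\<close> is only available for scalar functions, analyticity of a map
  into \<open>\<complex> \<times> \<complex> \<times> \<complex>\<close> is stated componentwise.\<close>

definition tetrablock_inner :: "(complex \<Rightarrow> complex \<times> complex \<times> complex) \<Rightarrow> bool" where
  "tetrablock_inner f \<longleftrightarrow>
     (\<lambda>z. fst (f z)) holomorphic_on unit_disc \<and>
     (\<lambda>z. fst (snd (f z))) holomorphic_on unit_disc \<and>
     (\<lambda>z. snd (snd (f z))) holomorphic_on unit_disc \<and>
     f ` unit_disc \<subseteq> closure tetrablock \<and>
     (AE \<zeta> in circle_measure. \<exists>L. radial_limit f \<zeta> L \<and> L \<in> tetrablock_boundary)"

text \<open>The library's \<open>convex\<close> needs a real vector space type, which the function type is not;
  this is its definition with the vector space operations taken pointwise.\<close>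

definition convex_pointwise :: "('a \<Rightarrow> 'b::real_vector) set \<Rightarrow> bool" where
  "convex_pointwise S \<longleftrightarrow>
     (\<forall>f\<in>S. \<forall>g\<in>S. \<forall>u\<ge>0. \<forall>v\<ge>0. u + v = 1 \<longrightarrow> (\<lambda>z. u *\<^sub>R f z + v *\<^sub>R g z) \<in> S)"

end

theory Submission
  imports Defs
begin

text \<open>The idea is that, for a fixed third coordinate \<open>x3\<close>, the fibre of the closed tetrablock
  over \<open>x3\<close> is convex, and so is the fibre of its distinguished boundary; everything else in the
  definition of an inner map is linear. For the boundary convexity is visible: \<open>x1 = cnj x2 * x3\<close>
  is real-linear in \<open>(x1, x2)\<close> and \<open>cmod x2 \<le> 1\<close> is convex. For the closed tetrablock the
  nonvanishing condition hides it, and one uses the Abouhajar-White-Young criterion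

    \<open>cmod (x1 - cnj x2 * x3) + cmod (x2 - cnj x1 * x3) < 1 - (cmod x3)\<^sup>2\<close>

  for membership in the open tetrablock (lemma \<open>tetrablock_iff\<close>), whose left-hand side is a convex
  function of \<open>(x1, x2)\<close>. Passing to the closure turns \<open><\<close> into \<open>\<le>\<close> at the price
  of the additional bound \<open>cmod x2 \<le> 1\<close>, which is only felt over the circle \<open>cmod x3 = 1\<close>,
  where the weak inequality reduces to \<open>x1 = cnj x2 * x3\<close> and does not bound the point
  (lemma \<open>closure_tetrablock_iff\<close>).

  For the radial limits, two inner maps with the same third component have limits with the same
  third coordinate at almost every point of the circle, by uniqueness of limits, so that these
  limits lie in one fibre of the distinguished boundary.\<close>

section \<open>A criterion for membership in the tetrablock\<close>

text \<open>Otherwise \<open>w * (x2 - x3 * z) = 1 - x1 * z\<close> has a solution \<open>w\<close> in the closed disc, which is a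
  zero of the defining polynomial.\<close>

lemma tetrablock_imp_norm_less:
  assumes "(x1, x2, x3) \<in> tetrablock" "cmod z \<le> 1"
  shows "cmod (x2 - x3 * z) < cmod (1 - x1 * z)"
proof (rule ccontr)
  assume neg: "\<not> ?thesis"
  have nz: "1 - x1 * z - x2 * w + x3 * z * w \<noteq> 0" if "cmod w \<le> 1" for w
    using assms that by (auto simp: tetrablock_def)
  have "1 - x1 * z \<noteq> 0" using nz[of 0] by simp
  with neg have d: "x2 - x3 * z \<noteq> 0" by auto
  define w where "w = (1 - x1 * z) / (x2 - x3 * z)"
  have "cmod w \<le> 1" using neg d by (simp add: w_def norm_divide divide_le_eq)
  moreover have "w * (x2 - x3 * z) = 1 - x1 * z" using d by (simp add: w_def)
  hence "1 - x1 * z - x2 * w + x3 * z * w = 0" by (simp add: algebra_simps)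
  ultimately show False using nz by blast
qed

lemma tetrablock_swap:
  assumes "(x1, x2, x3) \<in> tetrablock"
  shows "(x2, x1, x3) \<in> tetrablock"
proof -
  have "1 - x2 * z - x1 * w + x3 * z * w \<noteq> 0" if "cmod z \<le> 1" "cmod w \<le> 1" for z w
  proof -
    have "1 - x1 * w - x2 * z + x3 * w * z \<noteq> 0" using assms that by (auto simp: tetrablock_def)
    thus ?thesis by (simp add: algebra_simps)
  qed
  thus ?thesis by (simp add: tetrablock_def)
qed

text \<open>On the circle the previous lemma, squared, bounds \<open>2 * Re ((x1 - cnj x2 * x3) * z)\<close> by a
  quantity independent of \<open>z\<close>; the best choice of \<open>z\<close> makes the argument of \<open>Re\<close> positive.\<close>

lemma tetrablock_imp_half_criterion:
  assumes "(x1, x2, x3) \<in> tetrablock"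
  shows "2 * cmod (x1 - cnj x2 * x3) < 1 + (cmod x1)\<^sup>2 - (cmod x2)\<^sup>2 - (cmod x3)\<^sup>2"
proof -
  define a where "a = x1 - cnj x2 * x3"
  define z where "z = (if a = 0 then 1 else cnj a / of_real (cmod a))"
  have z1: "cmod z = 1" by (simp add: z_def norm_divide)
  have az: "Re (a * z) = cmod a"
  proof (cases "a = 0")
    case False
    have "a * z = of_real ((cmod a)\<^sup>2) / of_real (cmod a)"
      using False unfolding complex_norm_square by (simp add: z_def)
    also have "\<dots> = of_real (cmod a)" using False by (simp add: power2_eq_square)
    finally show ?thesis by simp
  qed simp
  have "(cmod (x2 - x3 * z))\<^sup>2 < (cmod (1 - x1 * z))\<^sup>2"
    using tetrablock_imp_norm_less[OF assms, of z] z1 by (simp add: power_strict_mono)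
  moreover have "(cmod (x2 - x3 * z))\<^sup>2 = (cmod x2)\<^sup>2 + (cmod x3)\<^sup>2 * (cmod z)\<^sup>2 - 2 * Re (cnj x2 * x3 * z)"
    by (simp only: cmod_power2) (simp add: power2_eq_square algebra_simps)
  moreover have "(cmod (1 - x1 * z))\<^sup>2 = 1 + (cmod x1)\<^sup>2 * (cmod z)\<^sup>2 - 2 * Re (x1 * z)"
    by (simp only: cmod_power2) (simp add: power2_eq_square algebra_simps)
  moreover have "Re (a * z) = Re (x1 * z) - Re (cnj x2 * x3 * z)"
    by (simp add: a_def algebra_simps)
  ultimately show ?thesis using az z1 by (simp add: a_def)
qed

lemma norm_diff_diff_square:
  "(cmod (a - b - c))\<^sup>2 = (cmod a)\<^sup>2 + (cmod b)\<^sup>2 + (cmod c)\<^sup>2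
     - 2 * Re (a * cnj b) - 2 * Re (a * cnj c) + 2 * Re (b * cnj c)"
  by (simp only: cmod_power2) (simp add: power2_eq_square algebra_simps)

text \<open>On the torus \<open>cmod z = cmod w = 1\<close> the two sides agree, the left one being \<open>z * w\<close> times
  the conjugate of the right one. Inside the bidisc the difference of the squares is written in terms of
  \<open>S = 1 - (cmod z)\<^sup>2\<close>, \<open>T = 1 - (cmod w)\<^sup>2\<close> and \<open>d = 1 - cmod b1 - cmod b2\<close>;
  this is an elementary substitute for the maximum principle.\<close>

lemma reflected_affine_le:
  fixes z w b1 b2 :: complex
  assumes z: "cmod z \<le> 1" and w: "cmod w \<le> 1" and b: "cmod b1 + cmod b2 \<le> 1"
  shows "cmod (z * w - cnj b2 * z - cnj b1 * w) \<le> cmod (1 - b1 * z - b2 * w)"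
proof -
  define p q s t where "p = cmod b1" and "q = cmod b2" and "s = cmod z" and "t = cmod w"
  define S T d where "S = 1 - s\<^sup>2" and "T = 1 - t\<^sup>2" and "d = 1 - p - q"
  have pq: "0 \<le> p" "0 \<le> q" "0 \<le> d" using b by (auto simp: p_def q_def d_def)
  have st: "0 \<le> s" "0 \<le> t" "s \<le> 1" "t \<le> 1" using z w by (auto simp: s_def t_def)
  have ST: "0 \<le> S" "0 \<le> T" "S \<le> 1" "T \<le> 1"
    using st by (auto simp: S_def T_def power_le_one)
  have id: "(cmod (1 - b1 * z - b2 * w))\<^sup>2 - (cmod (z * w - cnj b2 * z - cnj b1 * w))\<^sup>2
      = 1 - s\<^sup>2 * t\<^sup>2 + (p\<^sup>2 - q\<^sup>2) * (s\<^sup>2 - t\<^sup>2) - 2 * Re (b1 * z) * T - 2 * Re (b2 * w) * S"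
  proof -
    have "z * w * cnj (cnj b2 * z) = (b2 * w) * of_real (s\<^sup>2)"
         "z * w * cnj (cnj b1 * w) = (b1 * z) * of_real (t\<^sup>2)"
      unfolding s_def t_def complex_norm_square by (simp_all add: mult_ac)
    hence "Re (z * w * cnj (cnj b2 * z)) = Re (b2 * w) * s\<^sup>2"
          "Re (z * w * cnj (cnj b1 * w)) = Re (b1 * z) * t\<^sup>2"
      by (simp_all only: Re_complex_of_real Im_complex_of_real times_complex.sel mult_zero_right diff_zero)
    moreover have "(cnj b2 * z) * cnj (cnj b1 * w) = (b1 * z) * cnj (b2 * w)"
      by (simp add: mult_ac)
    ultimately show ?thesis
      unfolding norm_diff_diff_square norm_mult complex_mod_cnj complex_cnj_one norm_one
        S_def T_def p_def[symmetric] q_def[symmetric] s_def[symmetric] t_def[symmetric]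
      by (simp only: power_mult_distrib) (simp add: algebra_simps)
  qed
  \<comment> \<open>From \<open>2 * x \<le> 1 + x\<^sup>2\<close>: terms linear in \<open>s\<close> and \<open>t\<close> become linear in \<open>S\<close> and \<open>T\<close>.\<close>
  have amgm: "2 * (k * x) \<le> k * (2 - (1 - x\<^sup>2))" if "0 \<le> k" for k x :: real
  proof -
    have "0 \<le> k * (x - 1)\<^sup>2" using that by simp
    thus ?thesis by (simp add: power2_eq_square algebra_simps)
  qed
  have "Re (b1 * z) \<le> p * s" "Re (b2 * w) \<le> q * t"
    using complex_Re_le_cmod[of "b1 * z"] complex_Re_le_cmod[of "b2 * w"]
    by (auto simp: p_def q_def s_def t_def norm_mult)
  hence r1: "2 * Re (b1 * z) \<le> p * (2 - S)" and r2: "2 * Re (b2 * w) \<le> q * (2 - T)"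
    using amgm[OF pq(1), of s] amgm[OF pq(2), of t] by (auto simp: S_def T_def)
  have m: "2 * Re (b1 * z) * T \<le> p * (2 - S) * T" "2 * Re (b2 * w) * S \<le> q * (2 - T) * S"
    using mult_right_mono[OF r1 ST(2)] mult_right_mono[OF r2 ST(1)] by auto
  \<comment> \<open>With \<open>m\<close>, the lower bound for the difference of squares factors as \<open>d\<close> times
    \<open>S * (d + 2 * p) + T * (d + 2 * q) - S * T\<close>. Here the coefficients of \<open>S\<close> and \<open>T\<close> add up to \<open>2\<close>,
    and both \<open>S\<close> and \<open>T\<close> dominate \<open>S * T\<close>.\<close>
  have "S * T * (d + 2 * p) \<le> S * (d + 2 * p)" "S * T * (d + 2 * q) \<le> T * (d + 2 * q)"
    using pq ST by (auto intro!: mult_right_mono simp: mult_left_le mult_left_le_one_le)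
  hence "S * T * 2 \<le> S * (d + 2 * p) + T * (d + 2 * q)"
    by (simp add: d_def algebra_simps)
  moreover have "0 \<le> S * T" using ST by simp
  ultimately have "0 \<le> S * (d + 2 * p) + T * (d + 2 * q) - S * T" by linarith
  hence "0 \<le> d * (S * (d + 2 * p) + T * (d + 2 * q) - S * T)" using pq(3) by simp
  also have "\<dots> = S + T - S * T + (p\<^sup>2 - q\<^sup>2) * (T - S) - p * (2 - S) * T - q * (2 - T) * S"
    by (simp add: d_def power2_eq_square algebra_simps)
  also have "\<dots> = 1 - s\<^sup>2 * t\<^sup>2 + (p\<^sup>2 - q\<^sup>2) * (s\<^sup>2 - t\<^sup>2) - p * (2 - S) * T - q * (2 - T) * S"
    by (simp add: S_def T_def algebra_simps)
  also have "\<dots> \<le> (cmod (1 - b1 * z - b2 * w))\<^sup>2 - (cmod (z * w - cnj b2 * z - cnj b1 * w))\<^sup>2"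
    using id m by linarith
  finally have "(cmod (z * w - cnj b2 * z - cnj b1 * w))\<^sup>2 \<le> (cmod (1 - b1 * z - b2 * w))\<^sup>2"
    by (simp only: diff_ge_0_iff_ge)
  thus ?thesis by (rule power2_le_imp_le) (rule norm_ge_zero)
qed

text \<open>In the parameters \<open>b1, b2\<close> the defining polynomial splits as \<open>1 - b1 * z - b2 * w\<close>, which is
  nonzero, plus \<open>x3\<close> times its reflection, which is no larger.\<close>

lemma tetrablock_parametrized:
  assumes b: "cmod b1 + cmod b2 < 1" and x3: "cmod x3 < 1"
  shows "(b1 + cnj b2 * x3, b2 + cnj b1 * x3, x3) \<in> tetrablock"
proof -
  have "1 - (b1 + cnj b2 * x3) * z - (b2 + cnj b1 * x3) * w + x3 * z * w \<noteq> 0"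
    if z: "cmod z \<le> 1" and w: "cmod w \<le> 1" for z w
  proof
    assume eq: "1 - (b1 + cnj b2 * x3) * z - (b2 + cnj b1 * x3) * w + x3 * z * w = 0"
    define A B where "A = 1 - b1 * z - b2 * w" and "B = z * w - cnj b2 * z - cnj b1 * w"
    have "cmod (b1 * z + b2 * w) \<le> cmod b1 * cmod z + cmod b2 * cmod w"
      by (metis norm_mult norm_triangle_ineq)
    also have "\<dots> \<le> cmod b1 + cmod b2"
      using z w by (intro add_mono mult_left_le) auto
    finally have "b1 * z + b2 * w \<noteq> 1" using b by auto
    hence A: "A \<noteq> 0" by (auto simp: A_def algebra_simps)
    have "A = - (x3 * B)" using eq by (simp add: A_def B_def algebra_simps)
    hence "cmod A = cmod x3 * cmod B" by (simp add: norm_mult)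
    also have "\<dots> \<le> cmod x3 * cmod A"
      using reflected_affine_le[OF z w, of b1 b2] b by (intro mult_left_mono) (auto simp: A_def B_def)
    also have "\<dots> < cmod A" using x3 A by simp
    finally show False by simp
  qed
  thus ?thesis by (simp add: tetrablock_def)
qed

text \<open>Adding the two half criteria gives one direction. For the other, the real-linear system
  \<open>x1 = b1 + cnj b2 * x3\<close>, \<open>x2 = b2 + cnj b1 * x3\<close> is inverted.\<close>

lemma tetrablock_iff:
  "(x1, x2, x3) \<in> tetrablock \<longleftrightarrow>
     cmod (x1 - cnj x2 * x3) + cmod (x2 - cnj x1 * x3) < 1 - (cmod x3)\<^sup>2"
proof
  assume "(x1, x2, x3) \<in> tetrablock"
  from tetrablock_imp_half_criterion[OF this] tetrablock_imp_half_criterion[OF tetrablock_swap[OF this]]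
  show "cmod (x1 - cnj x2 * x3) + cmod (x2 - cnj x1 * x3) < 1 - (cmod x3)\<^sup>2"
    by linarith
next
  assume less: "cmod (x1 - cnj x2 * x3) + cmod (x2 - cnj x1 * x3) < 1 - (cmod x3)\<^sup>2"
  define k where "k = 1 - (cmod x3)\<^sup>2"
  have k: "0 < k"
    using less norm_ge_zero[of "x1 - cnj x2 * x3"] norm_ge_zero[of "x2 - cnj x1 * x3"]
    unfolding k_def by linarith
  hence x3: "cmod x3 < 1"
    using power2_less_imp_less[of "cmod x3" 1] by (simp add: k_def)
  define b1 b2 where "b1 = (x1 - cnj x2 * x3) / of_real k" and "b2 = (x2 - cnj x1 * x3) / of_real k"
  have "cmod b1 + cmod b2 < 1"
    using less[folded k_def] k by (simp add: b1_def b2_def norm_divide flip: add_divide_distrib)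
  note * = tetrablock_parametrized[OF this x3]
  have kc: "complex_of_real k = 1 - x3 * cnj x3"
    by (simp add: k_def flip: complex_norm_square)
  have kb: "of_real k * b1 = x1 - cnj x2 * x3" "of_real k * b2 = x2 - cnj x1 * x3"
       "of_real k * cnj b1 = cnj x1 - x2 * cnj x3" "of_real k * cnj b2 = cnj x2 - x1 * cnj x3"
    using k by (simp_all add: b1_def b2_def)
  have "of_real k * (b1 + cnj b2 * x3) = of_real k * x1" "of_real k * (b2 + cnj b1 * x3) = of_real k * x2"
    unfolding distrib_left mult.assoc[symmetric] kb by (simp_all add: kc algebra_simps)
  hence "b1 + cnj b2 * x3 = x1" "b2 + cnj b1 * x3 = x2"
    using k by simp_all
  with * show "(x1, x2, x3) \<in> tetrablock" by simp
qed

section \<open>The closed tetrablock\<close>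

text \<open>A point satisfying the weak inequality is approximated from inside: if \<open>cmod x3 < 1\<close>, by shrinking
  \<open>x1\<close> and \<open>x2\<close> alone, which scales the left-hand side and keeps the right-hand side; if
  \<open>cmod x3 = 1\<close>, by \<open>(r * x1, r * x2, r\<^sup>2 * x3)\<close>, for which the
  criterion amounts to \<open>2 * r * cmod x2 < 1 + r\<^sup>2\<close>.\<close>

lemma closure_tetrablock_iff:
  "(x1, x2, x3) \<in> closure tetrablock \<longleftrightarrow>
     cmod x2 \<le> 1 \<and> cmod (x1 - cnj x2 * x3) + cmod (x2 - cnj x1 * x3) \<le> 1 - (cmod x3)\<^sup>2"
    (is "_ \<longleftrightarrow> ?C")
proof
  define K where "K = {x :: complex \<times> complex \<times> complex. cmod (fst (snd x)) \<le> 1 \<and>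
      cmod (fst x - cnj (fst (snd x)) * snd (snd x)) + cmod (fst (snd x) - cnj (fst x) * snd (snd x))
        \<le> 1 - (cmod (snd (snd x)))\<^sup>2}"
  have "closed K"
    unfolding K_def by (intro closed_Collect_conj closed_Collect_le continuous_intros)
  moreover have "tetrablock \<subseteq> K"
  proof
    fix x :: "complex \<times> complex \<times> complex" assume x: "x \<in> tetrablock"
    obtain y1 y2 y3 where y: "x = (y1, y2, y3)" by (cases x) auto
    show "x \<in> K"
      using x tetrablock_iff[of y1 y2 y3] tetrablock_imp_norm_less[of y1 y2 y3 0]
      unfolding y K_def by simp
  qed
  ultimately have "closure tetrablock \<subseteq> K" by (rule closure_minimal[rotated])
  moreover assume "(x1, x2, x3) \<in> closure tetrablock"
  ultimately show ?C by (auto simp: K_def)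
next
  assume C: ?C
  hence x2: "cmod x2 \<le> 1"
    and le: "cmod (x1 - cnj x2 * x3) + cmod (x2 - cnj x1 * x3) \<le> 1 - (cmod x3)\<^sup>2" by auto
  have "0 \<le> 1 - (cmod x3)\<^sup>2"
    using le norm_ge_zero[of "x1 - cnj x2 * x3"] norm_ge_zero[of "x2 - cnj x1 * x3"] by linarith
  hence sq: "(cmod x3)\<^sup>2 \<le> 1" by simp
  have ev: "eventually (\<lambda>r::real. r \<in> {0<..<1}) (at_left 1)"
    by (rule eventually_at_left_real) simp
  show "(x1, x2, x3) \<in> closure tetrablock"
  proof (cases "(cmod x3)\<^sup>2 = 1")
    case False
    define p where "p = (\<lambda>r::real. (of_real r * x1, of_real r * x2, x3))"
    have "p r \<in> closure tetrablock" if r: "r \<in> {0<..<1}" for r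
    proof -
      have "of_real r * x1 - cnj (of_real r * x2) * x3 = of_real r * (x1 - cnj x2 * x3)"
           "of_real r * x2 - cnj (of_real r * x1) * x3 = of_real r * (x2 - cnj x1 * x3)"
        by (simp_all add: algebra_simps)
      hence "cmod (of_real r * x1 - cnj (of_real r * x2) * x3) + cmod (of_real r * x2 - cnj (of_real r * x1) * x3)
          = r * (cmod (x1 - cnj x2 * x3) + cmod (x2 - cnj x1 * x3))"
        using r by (simp only: norm_mult) (simp add: algebra_simps)
      also have "\<dots> \<le> r * (1 - (cmod x3)\<^sup>2)" using le r by (intro mult_left_mono) auto
      also have "\<dots> < 1 - (cmod x3)\<^sup>2" using r sq False by simp
      finally have "p r \<in> tetrablock" by (simp only: p_def tetrablock_iff)
      thus ?thesis using closure_subset by blast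
    qed
    hence "eventually (\<lambda>r. p r \<in> closure tetrablock) (at_left 1)"
      using ev by (rule eventually_mono[rotated])
    moreover have "(p \<longlongrightarrow> (of_real 1 * x1, of_real 1 * x2, x3)) (at_left 1)"
      unfolding p_def by (intro tendsto_intros)
    ultimately show ?thesis
      using Lim_in_closed_set[OF closed_closure, of p tetrablock "at_left 1"] by simp
  next
    case True
    have "cmod (x1 - cnj x2 * x3) = 0"
      using le True norm_ge_zero[of "x1 - cnj x2 * x3"] norm_ge_zero[of "x2 - cnj x1 * x3"] by linarith
    hence x1: "x1 = cnj x2 * x3" by simp
    have n3: "cmod x3 = 1" using True power2_eq_imp_eq[of "cmod x3" 1] by simp
    hence u: "x3 * cnj x3 = 1" by (simp add: complex_norm_square[symmetric])
    define p where "p = (\<lambda>r::real. (of_real r * x1, of_real r * x2, of_real (r\<^sup>2) * x3))"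
    have "p r \<in> closure tetrablock" if r: "r \<in> {0<..<1}" for r
    proof -
      have r2: "0 < 1 - r\<^sup>2" using r by (simp add: power_less_one_iff)
      have "of_real r * x1 - cnj (of_real r * x2) * (of_real (r\<^sup>2) * x3) = of_real (r * (1 - r\<^sup>2)) * (cnj x2 * x3)"
        by (simp add: x1 algebra_simps)
      moreover have "of_real r * x2 - cnj (of_real r * x1) * (of_real (r\<^sup>2) * x3)
          = of_real r * x2 - of_real (r * r\<^sup>2) * x2 * (x3 * cnj x3)"
        by (simp add: x1 algebra_simps)
      hence "of_real r * x2 - cnj (of_real r * x1) * (of_real (r\<^sup>2) * x3) = of_real (r * (1 - r\<^sup>2)) * x2"
        by (simp add: u algebra_simps)
      moreover have "0 \<le> r * (1 - r\<^sup>2)" using r r2 by simp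
      ultimately have "cmod (of_real r * x1 - cnj (of_real r * x2) * (of_real (r\<^sup>2) * x3))
           + cmod (of_real r * x2 - cnj (of_real r * x1) * (of_real (r\<^sup>2) * x3))
          = 2 * r * (1 - r\<^sup>2) * cmod x2"
        by (simp only: norm_mult norm_of_real complex_mod_cnj n3 abs_of_nonneg)
      also have "\<dots> \<le> 2 * r * (1 - r\<^sup>2)" using r r2 x2 by (intro mult_left_le) auto
      also have "\<dots> < (1 + r\<^sup>2) * (1 - r\<^sup>2)"
      proof (rule mult_strict_right_mono[OF _ r2])
        have "0 < (1 - r)\<^sup>2" using r by simp
        thus "2 * r < 1 + r\<^sup>2" by (simp add: power2_eq_square algebra_simps)
      qed
      also have "\<dots> = 1 - (cmod (of_real (r\<^sup>2) * x3))\<^sup>2"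
        by (simp add: norm_mult n3 norm_power power2_eq_square algebra_simps)
      finally have "p r \<in> tetrablock" by (simp only: p_def tetrablock_iff)
      thus ?thesis using closure_subset by blast
    qed
    hence "eventually (\<lambda>r. p r \<in> closure tetrablock) (at_left 1)"
      using ev by (rule eventually_mono[rotated])
    moreover have "(p \<longlongrightarrow> (of_real 1 * x1, of_real 1 * x2, of_real (1\<^sup>2) * x3)) (at_left 1)"
      unfolding p_def by (intro tendsto_intros)
    ultimately show ?thesis
      using Lim_in_closed_set[OF closed_closure, of p tetrablock "at_left 1"] by simp
  qed
qed

section \<open>Convexity of the fibres over the third coordinate\<close>

lemma norm_convex_combination_le:
  fixes a b :: "'a::real_normed_vector"
  assumes "0 \<le> u" "0 \<le> v"
  shows "norm (u *\<^sub>R a + v *\<^sub>R b) \<le> u * norm a + v * norm b"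
  using norm_triangle_ineq[of "u *\<^sub>R a" "v *\<^sub>R b"] assms by simp

lemma convex_combination_same:
  fixes c :: "'a::real_vector"
  assumes "u + v = 1"
  shows "u *\<^sub>R c + v *\<^sub>R c = c"
  using assms by (simp flip: scaleR_left_distrib)

lemma closure_tetrablock_fibre_convex:
  assumes x: "x \<in> closure tetrablock" and y: "y \<in> closure tetrablock"
    and eq: "snd (snd x) = snd (snd y)" and u: "0 \<le> u" "0 \<le> v" "u + v = 1"
  shows "u *\<^sub>R x + v *\<^sub>R y \<in> closure tetrablock"
proof -
  obtain x1 x2 c where X: "x = (x1, x2, c)" by (cases x) auto
  obtain y1 y2 where Y: "y = (y1, y2, c)" using eq X by (cases y) auto
  define k where "k = 1 - (cmod c)\<^sup>2"
  let ?z1 = "u *\<^sub>R x1 + v *\<^sub>R y1" and ?z2 = "u *\<^sub>R x2 + v *\<^sub>R y2"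
  have hx: "cmod x2 \<le> 1" "cmod (x1 - cnj x2 * c) + cmod (x2 - cnj x1 * c) \<le> k"
    and hy: "cmod y2 \<le> 1" "cmod (y1 - cnj y2 * c) + cmod (y2 - cnj y1 * c) \<le> k"
    using x y by (auto simp: X Y closure_tetrablock_iff k_def)
  have "?z1 - cnj ?z2 * c = u *\<^sub>R (x1 - cnj x2 * c) + v *\<^sub>R (y1 - cnj y2 * c)"
       "?z2 - cnj ?z1 * c = u *\<^sub>R (x2 - cnj x1 * c) + v *\<^sub>R (y2 - cnj y1 * c)"
    by (simp_all add: scaleR_conv_of_real algebra_simps)
  hence "cmod (?z1 - cnj ?z2 * c) + cmod (?z2 - cnj ?z1 * c)
      \<le> (u * cmod (x1 - cnj x2 * c) + v * cmod (y1 - cnj y2 * c))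
        + (u * cmod (x2 - cnj x1 * c) + v * cmod (y2 - cnj y1 * c))"
    using u by (simp only:) (intro add_mono norm_convex_combination_le)
  also have "\<dots> = u * (cmod (x1 - cnj x2 * c) + cmod (x2 - cnj x1 * c))
        + v * (cmod (y1 - cnj y2 * c) + cmod (y2 - cnj y1 * c))"
    by (simp add: algebra_simps)
  also have "\<dots> \<le> k" using convex_bound_le[OF hx(2) hy(2) u] .
  finally have "cmod (?z1 - cnj ?z2 * c) + cmod (?z2 - cnj ?z1 * c) \<le> k" .
  moreover have "cmod ?z2 \<le> 1"
    using norm_convex_combination_le[OF u(1,2), of x2 y2] convex_bound_le[OF hx(1) hy(1) u] by linarith
  ultimately have "(?z1, ?z2, c) \<in> closure tetrablock"
    by (simp only: closure_tetrablock_iff k_def simp_thms)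
  thus ?thesis using convex_combination_same[OF u(3), of c] by (simp add: X Y)
qed

lemma tetrablock_boundary_fibre_convex:
  assumes x: "x \<in> tetrablock_boundary" and y: "y \<in> tetrablock_boundary"
    and eq: "snd (snd x) = snd (snd y)" and u: "0 \<le> u" "0 \<le> v" "u + v = 1"
  shows "u *\<^sub>R x + v *\<^sub>R y \<in> tetrablock_boundary"
proof -
  obtain x1 x2 c where X: "x = (x1, x2, c)" by (cases x) auto
  obtain y1 y2 where Y: "y = (y1, y2, c)" using eq X by (cases y) auto
  have h: "x1 = cnj x2 * c" "y1 = cnj y2 * c" "cmod c = 1" "cmod x2 \<le> 1" "cmod y2 \<le> 1"
    using x y by (auto simp: X Y tetrablock_boundary_def)
  have "cmod (u *\<^sub>R x2 + v *\<^sub>R y2) \<le> 1"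
    using norm_convex_combination_le[OF u(1,2), of x2 y2] convex_bound_le[OF h(4,5) u] by linarith
  moreover have "u *\<^sub>R x1 + v *\<^sub>R y1 = cnj (u *\<^sub>R x2 + v *\<^sub>R y2) * c"
    by (simp add: h(1,2) scaleR_conv_of_real algebra_simps)
  ultimately have "(u *\<^sub>R x1 + v *\<^sub>R y1, u *\<^sub>R x2 + v *\<^sub>R y2, c) \<in> tetrablock_boundary"
    using h(3) by (simp add: tetrablock_boundary_def)
  thus ?thesis using convex_combination_same[OF u(3), of c] by (simp add: X Y)
qed

section \<open>Inner maps with a common third component\<close>

text \<open>The radius through a point of the circle stays in the disc, so maps that agree on the disc have
  the same radial limits.\<close>

lemma radial_limit_unique:
  fixes f g :: "complex \<Rightarrow> 'b::t2_space"
  assumes "radial_limit f \<zeta> L" "radial_limit g \<zeta> M" "\<zeta> \<in> unit_circle"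
    and "\<And>z. z \<in> unit_disc \<Longrightarrow> f z = g z"
  shows "L = M"
proof -
  have "eventually (\<lambda>r::real. r \<in> {0<..<1}) (at_left 1)"
    by (rule eventually_at_left_real) simp
  hence "eventually (\<lambda>r. f (of_real r * \<zeta>) = g (of_real r * \<zeta>)) (at_left 1)"
    by (rule eventually_mono) (use assms(3,4) in \<open>simp add: norm_mult\<close>)
  with assms(1) have "((\<lambda>r. g (of_real r * \<zeta>)) \<longlongrightarrow> L) (at_left 1)"
    unfolding radial_limit_def by (rule Lim_transform_eventually)
  with assms(2) show ?thesis
    unfolding radial_limit_def by (metis tendsto_unique trivial_limit_at_left_real)
qed

lemma space_circle_measure: "space circle_measure = unit_circle"
  by (simp add: circle_measure_def space_restrict_space)

lemma tetrablock_inner_convex_combination: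
  assumes f: "tetrablock_inner f" and g: "tetrablock_inner g"
    and eq: "\<And>z. z \<in> unit_disc \<Longrightarrow> snd (snd (f z)) = snd (snd (g z))"
    and u: "0 \<le> u" "0 \<le> v" "u + v = 1"
  shows "tetrablock_inner (\<lambda>z. u *\<^sub>R f z + v *\<^sub>R g z)"
proof -
  have "(\<lambda>z. u *\<^sub>R f z + v *\<^sub>R g z) ` unit_disc \<subseteq> closure tetrablock"
    using f g eq u by (auto simp: tetrablock_inner_def image_subset_iff
        intro!: closure_tetrablock_fibre_convex simp del: scaleR_Pair)
  moreover have "AE \<zeta> in circle_measure. \<exists>L. radial_limit (\<lambda>z. u *\<^sub>R f z + v *\<^sub>R g z) \<zeta> L
      \<and> L \<in> tetrablock_boundary"
  proof -
    have "AE \<zeta> in circle_measure. \<exists>L. radial_limit f \<zeta> L \<and> L \<in> tetrablock_boundary"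
         "AE \<zeta> in circle_measure. \<exists>L. radial_limit g \<zeta> L \<and> L \<in> tetrablock_boundary"
      using f g by (auto simp: tetrablock_inner_def)
    with AE_space[of circle_measure] show ?thesis
    proof eventually_elim
      case (elim \<zeta>)
      then obtain L M where L: "radial_limit f \<zeta> L" "L \<in> tetrablock_boundary"
        and M: "radial_limit g \<zeta> M" "M \<in> tetrablock_boundary" by blast
      have "snd (snd L) = snd (snd M)"
      proof (rule radial_limit_unique)
        show "radial_limit (\<lambda>z. snd (snd (f z))) \<zeta> (snd (snd L))"
             "radial_limit (\<lambda>z. snd (snd (g z))) \<zeta> (snd (snd M))"
          using L(1) M(1) unfolding radial_limit_def by (auto intro!: tendsto_snd)
      qed (use elim eq in \<open>auto simp: space_circle_measure\<close>)
      hence "u *\<^sub>R L + v *\<^sub>R M \<in> tetrablock_boundary"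
        using L M u by (intro tetrablock_boundary_fibre_convex)
      moreover have "radial_limit (\<lambda>z. u *\<^sub>R f z + v *\<^sub>R g z) \<zeta> (u *\<^sub>R L + v *\<^sub>R M)"
        using L(1) M(1) unfolding radial_limit_def by (intro tendsto_intros)
      ultimately show ?case by blast
    qed
  qed
  ultimately show ?thesis
    using f g unfolding tetrablock_inner_def
    by (auto simp: scaleR_conv_of_real intro!: holomorphic_intros)
qed

theorem theorem6p5:
  fixes x3 :: "complex \<Rightarrow> complex"
  assumes "inner_function x3"
  shows "convex_pointwise {f. tetrablock_inner f \<and> (\<forall>z\<in>unit_disc. snd (snd (f z)) = x3 z)}"
  unfolding convex_pointwise_def
proof (intro ballI allI impI)
  fix f g and u v :: real
  assume f: "f \<in> {f. tetrablock_inner f \<and> (\<forall>z\<in>unit_disc. snd (snd (f z)) = x3 z)}"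
    and g: "g \<in> {f. tetrablock_inner f \<and> (\<forall>z\<in>unit_disc. snd (snd (f z)) = x3 z)}"
    and u: "0 \<le> u" "0 \<le> v" "u + v = 1"
  have "tetrablock_inner (\<lambda>z. u *\<^sub>R f z + v *\<^sub>R g z)"
    using f g u by (intro tetrablock_inner_convex_combination) auto
  thus "(\<lambda>z. u *\<^sub>R f z + v *\<^sub>R g z) \<in> {f. tetrablock_inner f \<and> (\<forall>z\<in>unit_disc. snd (snd (f z)) = x3 z)}"
    using f g convex_combination_same[OF u(3)] by auto
qed

end
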